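(* Let $(P_q)$ be a sequence of $L^2$-normalized Littlewood polynomials such that the frequency of $-1$, $$\mathrm{fr}(-1)=\lim_{q\to+\infty}\frac{\#\{0\le j\le q-1:\ \epsilon_j^{(q)}=-1\}}{q},$$ exists. If $\mathrm{fr}(-1)\ne\tfrac12$, then for every real $\alpha>2$ the sequence $(P_q)$ is not $L^\alpha$-flat, and furthermore $$\lim_{q\to+\infty}\|P_q\|_\alpha=+\infty .$$
   Context: $S^1$ is the unit circle and $dz$ the normalized Lebesgue measure on it; all $L^\alpha$ norms are with respect to $dz$. A sequence $(P_q)$ of $L^2$-normalized Littlewood polynomials is indexed by $q$ running through an infinite set of positive integers, with $$P_q(z)=\frac1{\sqrt q}\sum_{j=0}^{q-1}\epsilon^{(q)}_j z^j,\qquad \epsilon^{(q)}_j\in\{+1,-1\},\ z\in S^1 .$$ Flatness: for real $\alpha>0$, a sequence $(P_n)$ of analytic trigonometric polynomials of $L^2(S^1,dz)$ norm $1$ is $L^\alpha$-flat if $|P_n|$ converges to the constant function $1$ in $L^\alpha$, i.e. $\int_{S^1}\big||P_n|-1\big|^\alpha dz\to 0$. *)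

theory Defs
  imports "HOL-Probability.Probability"
begin

definition circle_measure :: "complex measure" where
  "circle_measure =
     distr (uniform_measure lborel {0..<2 * pi}) (restrict_space borel (sphere 0 1)) cis"

text \<open>
  The integral below is the Bochner integral, which is 0 for non-integrable functions;
  the definition is meant for functions whose power is integrable, such as polynomials.
\<close>
definition Lnorm :: "real \<Rightarrow> (complex \<Rightarrow> complex) \<Rightarrow> real" where
  "Lnorm \<alpha> f = (LINT z|circle_measure. norm (f z) powr \<alpha>) powr (1 / \<alpha>)"

text \<open>The filter of limits \<open>q \<rightarrow> \<infinity>\<close> with \<open>q\<close> running through the index set \<open>Q\<close>.\<close>
abbreviation at_top_in :: "nat set \<Rightarrow> nat filter" where
  "at_top_in Q \<equiv> inf sequentially (principal Q)"

definition L_flat :: "real \<Rightarrow> nat set \<Rightarrow> (nat \<Rightarrow> complex \<Rightarrow> complex) \<Rightarrow> bool" where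
  "L_flat \<alpha> Q P \<longleftrightarrow>
     ((\<lambda>q. LINT z|circle_measure. \<bar>norm (P q z) - 1\<bar> powr \<alpha>) \<longlongrightarrow> 0) (at_top_in Q)"

text \<open>The argument \<open>\<epsilon>\<close> is the coefficient sequence of the single polynomial of index \<open>q\<close>.\<close>
definition littlewood :: "nat \<Rightarrow> (nat \<Rightarrow> real) \<Rightarrow> complex \<Rightarrow> complex" where
  "littlewood q \<epsilon> z = (1 / of_real (sqrt (real q))) * (\<Sum>j<q. of_real (\<epsilon> j) * z ^ j)"

lemma measurable_cis_circle:
  "cis \<in> measurable borel (restrict_space borel (sphere 0 1))"
  by (intro measurable_restrict_space2 borel_measurable_continuous_onI continuous_intros) auto

lemma prob_space_circle_measure: "prob_space circle_measure"
proof -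
  have "prob_space (uniform_measure lborel {0..<2 * pi})"
    by (intro prob_space_uniform_measure) (auto simp: emeasure_lborel_Ico)
  moreover have "cis \<in> measurable (uniform_measure lborel {0..<2 * pi}) (restrict_space borel (sphere 0 1))"
    using measurable_cis_circle by (simp cong: measurable_cong_sets)
  ultimately show ?thesis
    unfolding circle_measure_def by (rule prob_space.prob_space_distr)
qed

end

theory Submission
  imports Defs "HOL-Real_Asymp.Real_Asymp"
begin

text \<open>
  At \<open>z = 1\<close> the polynomial has modulus \<open>\<surd>q \<bar>1 - 2 fr\<^sub>q(-1)\<bar>\<close>, hence at least \<open>c \<surd>q\<close> for
  large \<open>q\<close>. As \<open>P\<^sub>q\<close> is Lipschitz with constant \<open>q \<surd>q\<close>, its modulus stays above
  \<open>c \<surd>q / 2\<close> on an arc of length \<open>c / (2 q)\<close>, which alone contributes a multiple of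
  \<open>q powr (\<alpha> / 2 - 1)\<close> to the integral of \<open>\<bar>P\<^sub>q\<bar> powr \<alpha>\<close>.
\<close>

text \<open>Pulled back along \<open>cis\<close>, the integral is taken over
  \<open>[0, 2 pi)\<close> with its uniform probability measure, under which the arc has mass
  \<open>d / (2 * pi)\<close>. There \<open>f\<close> dominates the step function equal to
  \<open>m\<close> on the arc and to 0 elsewhere.\<close>

lemma circle_integral_ge_arc:
  fixes f :: "complex \<Rightarrow> real"
  assumes cont: "continuous_on (sphere 0 1) f"
    and nonneg: "\<And>z. f z \<ge> 0"
    and d: "0 \<le> d" "d \<le> 2 * pi"
    and m: "\<And>t. 0 \<le> t \<Longrightarrow> t < d \<Longrightarrow> m \<le> f (cis t)"
  shows "d / (2 * pi) * m \<le> (LINT z|circle_measure. f z)"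
proof -
  define U where "U = uniform_measure lborel {0..<2 * pi}"
  interpret U: prob_space U
    unfolding U_def by (intro prob_space_uniform_measure) (auto simp: emeasure_lborel_Ico)
  have f: "f \<in> borel_measurable (restrict_space borel (sphere 0 1))"
    using cont by (intro borel_measurable_continuous_on_restrict)
  have cis: "cis \<in> measurable U (restrict_space borel (sphere 0 1))"
    unfolding U_def using measurable_cis_circle by (simp cong: measurable_cong_sets)
  have eq: "(LINT z|circle_measure. f z) = (LINT t|U. f (cis t))"
    unfolding circle_measure_def U_def[symmetric] using cis f by (rule integral_distr)
  \<comment> \<open>Compactness of the circle bounds \<open>f\<close>, which makes it integrable.
    Monotonicity of the Bochner integral requires this, since a non-integrable function would get
    the integral 0.\<close>
  have "bounded (f ` sphere 0 1)"
    using cont by (intro compact_imp_bounded compact_continuous_image) auto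
  then obtain B where B: "\<And>z. z \<in> sphere 0 1 \<Longrightarrow> norm (f z) \<le> B"
    unfolding bounded_iff by blast
  have int: "integrable U (\<lambda>t. f (cis t))"
    using B measurable_compose[OF cis f] by (intro U.integrable_const_bound[of _ B]) auto
  have "measure U {0..<d} = measure lborel ({0..<2 * pi} \<inter> {0..<d}) / measure lborel {0..<2 * pi}"
    unfolding U_def by (subst measure_uniform_measure) (auto simp: emeasure_lborel_Ico)
  also have "{0..<2 * pi} \<inter> {0..<d} = {0..<d}"
    using d by auto
  finally have meas: "measure U {0..<d} = d / (2 * pi)"
    using d by simp
  have sets: "{0..<d} \<in> sets U"
    by (simp add: U_def)
  have "d / (2 * pi) * m = (LINT t|U. indicator {0..<d} t * m)"
    using meas sets by (simp add: U_def)
  also have "\<dots> \<le> (LINT t|U. f (cis t))"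
  proof (rule integral_mono[OF _ int])
    show "integrable U (\<lambda>t. indicator {0..<d} t * m)"
      using sets by (intro integrable_mult_left integrable_real_indicator) (auto simp: less_top[symmetric])
  qed (use m nonneg in \<open>auto simp: indicator_def\<close>)
  finally show ?thesis
    using eq by simp
qed

lemma norm_cis_diff_1_le: "norm (cis t - 1) \<le> \<bar>t\<bar>"
proof -
  have "norm (cis t - 1) = 2 * \<bar>sin (t / 2)\<bar>"
    using dist_exp_i_1[of t] by (simp add: cis_conv_exp)
  then show ?thesis
    using abs_sin_x_le_abs_x[of "t / 2"] by simp
qed

lemma continuous_on_littlewood [continuous_intros]: "continuous_on S (littlewood q e)"
  unfolding littlewood_def by (intro continuous_intros)

text \<open>Each coefficient is 1 minus twice the indicator of being -1, so the coefficients add up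
  to \<open>q\<close> minus twice the number of -1's. For \<open>q = 0\<close> both sides are
  0.\<close>

lemma littlewood_1:
  assumes "\<And>j. j < q \<Longrightarrow> e j \<in> {1, -1}"
  shows "littlewood q e 1 =
           of_real (sqrt (real q) * (1 - 2 * (real (card {j. j < q \<and> e j = -1}) / real q)))"
proof (cases "q = 0")
  case False
  have "(\<Sum>j<q. e j) = (\<Sum>j<q. 1 - 2 * indicator {j. j < q \<and> e j = -1} j)"
    using assms by (intro sum.cong) (auto simp: indicator_def)
  also have "\<dots> = real q - 2 * (\<Sum>j<q. indicator {j. j < q \<and> e j = -1} j)"
    by (simp add: sum_subtractf sum_distrib_left)
  also have "(\<Sum>j<q. indicator {j. j < q \<and> e j = -1} j) = real (card {j. j < q \<and> e j = -1})"
    by (auto simp: indicator_def sum.If_cases intro!: arg_cong[of _ _ card])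
  finally have "(\<Sum>j<q. e j) = real q * (1 - 2 * (real (card {j. j < q \<and> e j = -1}) / real q))"
    using False by (simp add: right_diff_distrib)
  then have "(\<Sum>j<q. e j) / sqrt (real q)
      = sqrt (real q) * (1 - 2 * (real (card {j. j < q \<and> e j = -1}) / real q))"
    by (simp only: times_divide_eq_left[symmetric] real_div_sqrt of_nat_0_le_iff)
  then show ?thesis
    unfolding littlewood_def by (simp flip: of_real_sum of_real_divide)
qed (simp add: littlewood_def)

text \<open>On the unit disc \<open>z ^ j\<close> is Lipschitz with constant \<open>j\<close>, here
  bounded crudely by \<open>q\<close>. The \<open>q\<close> terms together give
  \<open>q * q\<close>, and the normalization divides this by \<open>sqrt q\<close>.\<close>

lemma littlewood_lipschitz:
  assumes e: "\<And>j. j < q \<Longrightarrow> \<bar>e j\<bar> \<le> 1" and z: "norm z \<le> 1" and w: "norm w \<le> 1"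
  shows "norm (littlewood q e z - littlewood q e w) \<le> real q * sqrt (real q) * norm (z - w)"
proof (cases "q = 0")
  case False
  have "norm (\<Sum>j<q. of_real (e j) * (z ^ j - w ^ j)) \<le> (\<Sum>j<q. real q * norm (z - w))"
  proof (rule sum_norm_le)
    fix j assume "j \<in> {..<q}"
    then have "\<bar>e j\<bar> * norm (z ^ j - w ^ j) \<le> 1 * (real j * norm (z - w))"
      using e z w by (intro mult_mono norm_power_diff) auto
    also have "\<dots> \<le> real q * norm (z - w)"
      using \<open>j \<in> {..<q}\<close> by (simp add: mult_right_mono)
    finally show "norm (of_real (e j) * (z ^ j - w ^ j)) \<le> real q * norm (z - w)"
      by (simp add: norm_mult)
  qed
  then have "norm (\<Sum>j<q. of_real (e j) * (z ^ j - w ^ j)) / sqrt (real q)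
      \<le> real q * (real q * norm (z - w)) / sqrt (real q)"
    by (intro divide_right_mono) auto
  also have "\<dots> = real q * sqrt (real q) * norm (z - w)"
    using False by (simp add: field_simps)
  also have "littlewood q e z - littlewood q e w
      = (1 / of_real (sqrt (real q))) * (\<Sum>j<q. of_real (e j) * (z ^ j - w ^ j))"
    unfolding littlewood_def by (simp add: algebra_simps sum_subtractf diff_divide_distrib)
  ultimately show ?thesis
    by (simp add: norm_mult norm_divide)
qed (simp add: littlewood_def)

text \<open>This is the quantitative core for a single \<open>q\<close>, so that only the growth of
  \<open>B\<close> remains for the limit. The constant \<open>c / 4\<close>, rather than
  \<open>c / 2\<close>, leaves room for subtracting 1 from the modulus, so one bound serves both
  integrals.\<close>

lemma littlewood_integrals_ge:
  assumes e: "\<And>j. j < q \<Longrightarrow> e j \<in> {1, -1}" and "q > 0" and c: "0 < c" "c \<le> 1"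
    and bias: "c \<le> \<bar>1 - 2 * (real (card {j. j < q \<and> e j = -1}) / real q)\<bar>"
    and large: "4 \<le> c * sqrt (real q)" and "\<alpha> > 0"
  defines "B \<equiv> c / (4 * pi) * (c / 4) powr \<alpha> * real q powr (\<alpha> / 2 - 1)"
  shows "B \<le> (LINT z|circle_measure. norm (littlewood q e z) powr \<alpha>)"
    and "B \<le> (LINT z|circle_measure. \<bar>norm (littlewood q e z) - 1\<bar> powr \<alpha>)"
proof -
  \<comment> \<open>The arc is just short enough that the Lipschitz bound lets the value drift by at
    most \<open>q * sqrt q * d = c * sqrt q / 2\<close>, half of the lower bound for the modulus at
    1.\<close>
  define d where "d = c / (2 * real q)"
  have "c \<le> real q"
    using \<open>q > 0\<close> c by linarith
  then have "d \<le> 1"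
    using \<open>q > 0\<close> by (simp add: d_def)
  then have d: "0 \<le> d" "d \<le> 2 * pi"
    using c pi_gt3 by (simp add: d_def, linarith)
  have lower: "c * sqrt (real q) / 2 \<le> norm (littlewood q e (cis t))" if "0 \<le> t" "t < d" for t
  proof -
    have "norm (littlewood q e 1 - littlewood q e (cis t))
        \<le> real q * sqrt (real q) * norm (1 - cis t)"
      using e by (intro littlewood_lipschitz) force+
    also have "\<dots> \<le> real q * sqrt (real q) * d"
      using norm_cis_diff_1_le[of t] that by (intro mult_left_mono) (auto simp: norm_minus_commute)
    also have "\<dots> = c * sqrt (real q) / 2"
      using \<open>q > 0\<close> by (simp add: d_def)
    finally have "norm (littlewood q e 1 - littlewood q e (cis t)) \<le> c * sqrt (real q) / 2" .
    moreover have "norm (littlewood q e 1) \<ge> c * sqrt (real q)"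
    proof -
      have "norm (littlewood q e 1)
          = sqrt (real q) * \<bar>1 - 2 * (real (card {j. j < q \<and> e j = -1}) / real q)\<bar>"
        using littlewood_1[of q e] e by (simp only: norm_of_real abs_mult) simp
      then show ?thesis
        using mult_left_mono[OF bias, of "sqrt (real q)"] by (simp add: mult.commute)
    qed
    ultimately show ?thesis
      using norm_triangle_ineq2[of "littlewood q e 1" "littlewood q e (cis t)"] by linarith
  qed
  \<comment> \<open>The \<open>-1\<close> in the exponent of \<open>q\<close> comes from the arc
    length, the \<open>\<alpha> / 2\<close> from the height \<open>sqrt q\<close>.\<close>
  have B: "B = d / (2 * pi) * (c / 4 * sqrt (real q)) powr \<alpha>"
  proof -
    have "(c / 4 * sqrt (real q)) powr \<alpha> = (c / 4) powr \<alpha> * real q powr (\<alpha> / 2)"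
      using c by (subst powr_mult) (simp_all add: powr_powr flip: powr_half_sqrt)
    moreover have "real q powr (\<alpha> / 2 - 1) = real q powr (\<alpha> / 2) / real q"
      using \<open>q > 0\<close> by (simp add: powr_diff)
    ultimately show ?thesis
      by (simp add: B_def d_def mult_ac)
  qed
  show "B \<le> (LINT z|circle_measure. norm (littlewood q e z) powr \<alpha>)"
    unfolding B
  proof (rule circle_integral_ge_arc[OF _ _ d])
    show "continuous_on (sphere 0 1) (\<lambda>z. norm (littlewood q e z) powr \<alpha>)"
      \<comment> \<open>The polynomial may vanish on the circle; a positive exponent keeps
        \<open>powr\<close> continuous at base 0.\<close>
      using \<open>\<alpha> > 0\<close> by (intro continuous_on_powr' continuous_intros) auto
    fix t assume "0 \<le> t" "t < d"
    then show "(c / 4 * sqrt (real q)) powr \<alpha> \<le> norm (littlewood q e (cis t)) powr \<alpha>"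
      using lower[of t] large c \<open>\<alpha> > 0\<close> by (intro powr_mono2) auto
  qed auto
  show "B \<le> (LINT z|circle_measure. \<bar>norm (littlewood q e z) - 1\<bar> powr \<alpha>)"
    unfolding B
  proof (rule circle_integral_ge_arc[OF _ _ d])
    show "continuous_on (sphere 0 1) (\<lambda>z. \<bar>norm (littlewood q e z) - 1\<bar> powr \<alpha>)"
      using \<open>\<alpha> > 0\<close> by (intro continuous_on_powr' continuous_intros) auto
    fix t assume "0 \<le> t" "t < d"
    \<comment> \<open>The assumption \<open>4 \<le> c * sqrt q\<close> says exactly that
      \<open>c * sqrt q / 2 - 1\<close> is still at least \<open>c * sqrt q / 4\<close>.\<close>
    then show "(c / 4 * sqrt (real q)) powr \<alpha> \<le> \<bar>norm (littlewood q e (cis t)) - 1\<bar> powr \<alpha>"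
      using lower[of t] large c \<open>\<alpha> > 0\<close> by (intro powr_mono2) auto
  qed auto
qed

theorem theorem2p2:
  fixes Q :: "nat set" and \<epsilon> :: "nat \<Rightarrow> nat \<Rightarrow> real" and P :: "nat \<Rightarrow> complex \<Rightarrow> complex"
    and fr :: real
  assumes "infinite Q" and "\<forall>q\<in>Q. q > 0"
    and "\<forall>q\<in>Q. \<forall>j<q. \<epsilon> q j \<in> {1, -1}"
    and "\<forall>q\<in>Q. P q = littlewood q (\<epsilon> q)"
    and "((\<lambda>q. real (card {j. j < q \<and> \<epsilon> q j = -1}) / real q) \<longlongrightarrow> fr) (at_top_in Q)"
    and "fr \<noteq> 1 / 2"
  shows "\<forall>\<alpha>>2. \<not> L_flat \<alpha> Q P \<and> filterlim (\<lambda>q. Lnorm \<alpha> (P q)) at_top (at_top_in Q)"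
proof (intro allI impI)
  fix \<alpha> :: real assume \<alpha>: "\<alpha> > 2"
  \<comment> \<open>Halving puts \<open>c\<close> strictly below the limiting bias, so the bias at
    \<open>q\<close> eventually exceeds it; the cap at 1 keeps the arc within the circle.\<close>
  define c where "c = min 1 (\<bar>1 - 2 * fr\<bar> / 2)"
  define B where "B q = c / (4 * pi) * (c / 4) powr \<alpha> * real q powr (\<alpha> / 2 - 1)" for q :: nat
  have c: "0 < c" "c \<le> 1" "c < \<bar>1 - 2 * fr\<bar>"
    using \<open>fr \<noteq> 1 / 2\<close> by (auto simp: c_def min_def)
  \<comment> \<open>Along the trivial filter every limit statement holds, flatness included.
    Infinitude of \<open>Q\<close> excludes this, so the same integrals cannot tend both to 0 and to
    infinity.\<close>
  have nontriv: "at_top_in Q \<noteq> bot"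
    using \<open>infinite Q\<close>
    by (auto simp: trivial_limit_def eventually_inf_principal eventually_sequentially
        infinite_nat_iff_unbounded_le)
  \<comment> \<open>Here \<open>\<alpha> > 2\<close> enters: it makes the exponent positive.\<close>
  have "filterlim (\<lambda>q. real q powr (\<alpha> / 2 - 1)) at_top sequentially"
    using \<alpha> by (intro filterlim_compose[OF real_powr_at_top filterlim_real_sequentially]) auto
  then have "filterlim B at_top sequentially"
    unfolding B_def using c by (intro filterlim_tendsto_pos_mult_at_top[OF tendsto_const]) auto
  then have B: "filterlim B at_top (at_top_in Q)"
    by (rule filterlim_mono) auto
  have "filterlim (\<lambda>q. c * sqrt (real q)) at_top sequentially"
    using c by (intro filterlim_tendsto_pos_mult_at_top[OF tendsto_const]
        filterlim_compose[OF sqrt_at_top filterlim_real_sequentially]) auto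
  then have large: "eventually (\<lambda>q. 4 \<le> c * sqrt (real q)) (at_top_in Q)"
    unfolding filterlim_at_top by (auto intro: filter_leD[OF inf_le1])
  have "((\<lambda>q. \<bar>1 - 2 * (real (card {j. j < q \<and> \<epsilon> q j = -1}) / real q)\<bar>) \<longlongrightarrow> \<bar>1 - 2 * fr\<bar>)
      (at_top_in Q)"
    using assms(5) by (intro tendsto_intros)
  then have bias: "eventually (\<lambda>q. c < \<bar>1 - 2 * (real (card {j. j < q \<and> \<epsilon> q j = -1}) / real q)\<bar>)
      (at_top_in Q)"
    using c by (intro order_tendstoD)
  have inQ: "eventually (\<lambda>q. q \<in> Q) (at_top_in Q)"
    by (simp add: eventually_inf_principal)
  have bounds: "eventually (\<lambda>q. B q \<le> (LINT z|circle_measure. norm (P q z) powr \<alpha>)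
      \<and> B q \<le> (LINT z|circle_measure. \<bar>norm (P q z) - 1\<bar> powr \<alpha>)) (at_top_in Q)"
    using large bias inQ
  proof eventually_elim
    case (elim q)
    then show ?case
      using littlewood_integrals_ge[of q "\<epsilon> q" c \<alpha>] assms(2-4) c \<alpha> by (auto simp: B_def)
  qed
  have "\<not> L_flat \<alpha> Q P"
  proof
    assume "L_flat \<alpha> Q P"
    moreover have "filterlim (\<lambda>q. LINT z|circle_measure. \<bar>norm (P q z) - 1\<bar> powr \<alpha>) at_top (at_top_in Q)"
      by (rule filterlim_at_top_mono[OF B]) (use bounds in eventually_elim, auto)
    ultimately show False
      using nontriv unfolding L_flat_def
      by (metis filterlim_at_top_imp_at_infinity not_tendsto_and_filterlim_at_infinity)
  qed
  \<comment> \<open>Taking the root of order \<open>\<alpha>\<close> preserves both divergence and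
    the comparison with \<open>B\<close>, whose values are nonnegative.\<close>
  moreover have "filterlim (\<lambda>q. B q powr (1 / \<alpha>)) at_top (at_top_in Q)"
    using \<alpha> by (intro filterlim_compose[OF real_powr_at_top B]) auto
  then have "filterlim (\<lambda>q. Lnorm \<alpha> (P q)) at_top (at_top_in Q)"
  proof (rule filterlim_at_top_mono)
    show "eventually (\<lambda>q. B q powr (1 / \<alpha>) \<le> Lnorm \<alpha> (P q)) (at_top_in Q)"
      using bounds
    proof eventually_elim
      case (elim q)
      then show ?case
        unfolding Lnorm_def using \<alpha> c by (intro powr_mono2) (auto simp: B_def)
    qed
  qed
  ultimately show "\<not> L_flat \<alpha> Q P \<and> filterlim (\<lambda>q. Lnorm \<alpha> (P q)) at_top (at_top_in Q)"
    by blast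
qed

end
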